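(* Let $\gamma\in\mathbb{C}$ and let $\mathrm{N}_\gamma$ be the admissible Novikov-Witt algebra. Then: (a1) If $\gamma\notin3\mathbb{Z}$, then $\mathfrak{Der}(\mathrm{N}_\gamma)=\langle\mathfrak{D}_1\rangle$, where $\mathfrak{D}_1(W_n)=nW_n$. (a2) If $\gamma\in3\mathbb{Z}$, then $\mathfrak{Der}(\mathrm{N}_\gamma)=\langle\mathfrak{D}_1,\mathfrak{D}_2\rangle$, where $\mathfrak{D}_2(W_n)=\big(n+\frac{\gamma}{3}\big)W_{n-\frac{\gamma}{3}}$. (b) $\mathfrak{Der}_{\frac12}(\mathrm{N}_\gamma)=\langle\mathrm{Id}\rangle$. (c) If $j\in\mathbb{Z}$, $j\notin\{0,-\frac{\gamma}{3}\}$, then $\mathfrak{F}_j(W_n)=\big(n+\frac{\gamma}{3}\big)W_{n+j}$ is a quasi-derivation with related mapping $\mathfrak{F}_j'(W_n)=\big(n+j+\frac{2\gamma}{3}\big)W_{n+j}$. The linear span of such quasi-derivations is denoted by $\mathrm{Q}\mathfrak{Der}^*(\mathrm{N}_\gamma)$. (d) $\mathrm{Q}\mathfrak{Der}(\mathrm{N}_\gamma)=\mathfrak{Der}(\mathrm{N}_\gamma)\oplus\mathfrak{Der}_{\frac12}(\mathrm{N}_\gamma)\oplus\mathrm{Q}\mathfrak{Der}^*(\mathrm{N}_\gamma)$.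
   Context: All algebras and vector spaces are over $\mathbb{C}$; $\langle S\rangle$ is the linear span of $S$. For $\gamma\in\mathbb{C}$, the admissible Novikov-Witt algebra $\mathrm{N}_\gamma$ is the algebra with basis $\{W_i\}_{i\in\mathbb{Z}}$ and multiplication $W_n\circ W_m=(\gamma+m+2n)W_{n+m}$. For an algebra $(\mathrm{A},\circ)$: a linear map $f:\mathrm{A}\to\mathrm{A}$ is a quasi-derivation with related mapping $f'$ if $f':\mathrm{A}\to\mathrm{A}$ is linear and $f(x)\circ y+x\circ f(y)=f'(x\circ y)$ for all $x,y$; the space of quasi-derivations is $\mathrm{Q}\mathfrak{Der}(\mathrm{A})$. For $\delta\in\mathbb{C}$, a linear map $\varphi$ is a $\delta$-derivation if $\varphi(x\circ y)=\delta(\varphi(x)\circ y+x\circ\varphi(y))$ for all $x,y$; the space of these is $\mathfrak{Der}_\delta(\mathrm{A})$, and $\mathfrak{Der}=\mathfrak{Der}_1$ is the space of derivations. *)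

theory Defs
  imports Complex_Main "HOL-Library.Poly_Mapping" "HOL-Library.Function_Algebras"
begin

(* An algebra is given by a scalar action scl and a multiplication mul on an abelian
   group type. *)

definition delta_derivations ::
    "(complex \<Rightarrow> 'a \<Rightarrow> 'a) \<Rightarrow> ('a \<Rightarrow> 'a \<Rightarrow> 'a) \<Rightarrow> complex \<Rightarrow> ('a::ab_group_add \<Rightarrow> 'a) set" where
  "delta_derivations scl mul \<delta> =
     {f. Vector_Spaces.linear scl scl f \<and>
         (\<forall>x y. f (mul x y) = scl \<delta> (mul (f x) y + mul x (f y)))}"

definition derivations ::
    "(complex \<Rightarrow> 'a \<Rightarrow> 'a) \<Rightarrow> ('a \<Rightarrow> 'a \<Rightarrow> 'a) \<Rightarrow> ('a::ab_group_add \<Rightarrow> 'a) set" where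
  "derivations scl mul = delta_derivations scl mul 1"

definition is_quasi_derivation ::
    "(complex \<Rightarrow> 'a \<Rightarrow> 'a) \<Rightarrow> ('a \<Rightarrow> 'a \<Rightarrow> 'a) \<Rightarrow> ('a::ab_group_add \<Rightarrow> 'a) \<Rightarrow> ('a \<Rightarrow> 'a) \<Rightarrow> bool" where
  "is_quasi_derivation scl mul f f' \<longleftrightarrow>
     Vector_Spaces.linear scl scl f \<and> Vector_Spaces.linear scl scl f' \<and>
     (\<forall>x y. mul (f x) y + mul x (f y) = f' (mul x y))"

definition quasi_derivations ::
    "(complex \<Rightarrow> 'a \<Rightarrow> 'a) \<Rightarrow> ('a \<Rightarrow> 'a \<Rightarrow> 'a) \<Rightarrow> ('a::ab_group_add \<Rightarrow> 'a) set" where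
  "quasi_derivations scl mul = {f. \<exists>f'. is_quasi_derivation scl mul f f'}"

definition fun_scale :: "(complex \<Rightarrow> 'a \<Rightarrow> 'a) \<Rightarrow> complex \<Rightarrow> ('a \<Rightarrow> 'a) \<Rightarrow> 'a \<Rightarrow> 'a" where
  "fun_scale scl c f = (\<lambda>x. scl c (f x))"

(* U is the internal direct sum of the subspaces A, B, C. *)
definition is_direct_sum3 ::
    "(complex \<Rightarrow> 'v \<Rightarrow> 'v) \<Rightarrow> 'v::ab_group_add set \<Rightarrow> 'v set \<Rightarrow> 'v set \<Rightarrow> 'v set \<Rightarrow> bool" where
  "is_direct_sum3 scl U A B C \<longleftrightarrow>
     module.subspace scl A \<and> module.subspace scl B \<and> module.subspace scl C \<and>
     U = {a + b + c | a b c. a \<in> A \<and> b \<in> B \<and> c \<in> C} \<and>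
     (\<forall>a\<in>A. \<forall>b\<in>B. \<forall>c\<in>C. a + b + c = 0 \<longrightarrow> a = 0 \<and> b = 0 \<and> c = 0)"

lemma vector_space_fun_scale:
  assumes "vector_space scl"
  shows "vector_space (fun_scale scl)"
proof -
  interpret vector_space scl by fact
  show ?thesis
    by standard (auto simp: fun_scale_def fun_eq_iff scale_right_distrib scale_left_distrib)
qed

(* The underlying space is the free complex vector space on the integers. *)

type_synonym nw = "int \<Rightarrow>\<^sub>0 complex"

definition nw_scale :: "complex \<Rightarrow> nw \<Rightarrow> nw" where
  "nw_scale c x = Poly_Mapping.map ((*) c) x"

definition W :: "int \<Rightarrow> nw" where
  "W n = Poly_Mapping.single n 1"

(* The linear map with values g n on the basis vectors W n. *)
definition nw_extend :: "(int \<Rightarrow> nw) \<Rightarrow> nw \<Rightarrow> nw" where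
  "nw_extend g x = (\<Sum>n\<in>Poly_Mapping.keys x. nw_scale (Poly_Mapping.lookup x n) (g n))"

definition nw_mult :: "complex \<Rightarrow> nw \<Rightarrow> nw \<Rightarrow> nw" where
  "nw_mult \<gamma> x y =
     nw_extend (\<lambda>n. nw_extend (\<lambda>m. nw_scale (\<gamma> + of_int m + 2 * of_int n) (W (n + m))) y) x"

lemma lookup_nw_scale [simp]:
  "Poly_Mapping.lookup (nw_scale c x) n = c * Poly_Mapping.lookup x n"
  by (simp add: nw_scale_def map.rep_eq when_def)

lemma vector_space_nw_scale: "vector_space nw_scale"
  by standard (auto intro!: poly_mapping_eqI simp: lookup_add algebra_simps)

lemma nw_linear_iff:
  "Vector_Spaces.linear nw_scale nw_scale f \<longleftrightarrow>
     (\<forall>x y. f (x + y) = f x + f y) \<and> (\<forall>c x. f (nw_scale c x) = nw_scale c (f x))"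
  using vector_space_nw_scale unfolding Vector_Spaces.linear_iff by blast

lemma nw_scale_1 [simp]: "nw_scale 1 x = x"
  by (rule poly_mapping_eqI) simp

lemma nw_extend_superset:
  assumes "finite A" "Poly_Mapping.keys x \<subseteq> A"
  shows "nw_extend g x = (\<Sum>n\<in>A. nw_scale (Poly_Mapping.lookup x n) (g n))"
proof -
  interpret vector_space nw_scale by (rule vector_space_nw_scale)
  show ?thesis unfolding nw_extend_def
    by (rule sum.mono_neutral_left) (use assms in \<open>auto simp: in_keys_iff\<close>)
qed

lemma linear_nw_extend: "Vector_Spaces.linear nw_scale nw_scale (nw_extend g)"
proof -
  interpret vector_space nw_scale by (rule vector_space_nw_scale)
  show ?thesis unfolding nw_linear_iff
  proof (intro conjI allI)
    fix x y :: nw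
    let ?A = "Poly_Mapping.keys x \<union> Poly_Mapping.keys y"
    have "Poly_Mapping.keys (x + y) \<subseteq> ?A" by (rule keys_add)
    then show "nw_extend g (x + y) = nw_extend g x + nw_extend g y"
      by (simp add: nw_extend_superset[of ?A] lookup_add scale_left_distrib sum.distrib)
  next
    fix c :: complex and x :: nw
    have "Poly_Mapping.keys (nw_scale c x) \<subseteq> Poly_Mapping.keys x"
      by (auto simp: in_keys_iff)
    then show "nw_extend g (nw_scale c x) = nw_scale c (nw_extend g x)"
      by (simp add: nw_extend_superset[of "Poly_Mapping.keys x"] scale_sum_right)
  qed
qed

lemma nw_extend_W [simp]: "nw_extend g (W n) = g n"
  by (simp add: nw_extend_def W_def)

lemma nw_mult_W:
  "nw_mult \<gamma> (W n) (W m) = nw_scale (\<gamma> + of_int m + 2 * of_int n) (W (n + m))"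
  by (simp add: nw_mult_def)

lemma linear_nw_mult_left: "Vector_Spaces.linear nw_scale nw_scale (\<lambda>x. nw_mult \<gamma> x y)"
  unfolding nw_mult_def by (rule linear_nw_extend)

lemma linear_nw_mult_right: "Vector_Spaces.linear nw_scale nw_scale (nw_mult \<gamma> x)"
proof -
  interpret vector_space nw_scale by (rule vector_space_nw_scale)
  show ?thesis unfolding nw_linear_iff nw_mult_def
    using linear_nw_extend[unfolded nw_linear_iff]
    by (simp add: nw_extend_def[of _ x] scale_right_distrib sum.distrib scale_sum_right
        mult.commute)
qed

lemma nw_sum_W: "x = (\<Sum>n\<in>Poly_Mapping.keys x. nw_scale (Poly_Mapping.lookup x n) (W n))"
  by (rule poly_mapping_eqI)
    (auto simp: lookup_sum W_def lookup_single when_def in_keys_iff if_distrib cong: if_cong)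

lemma basis_W:
  "inj W" "\<not> module.dependent nw_scale (range W)" "module.span nw_scale (range W) = UNIV"
proof -
  interpret vector_space nw_scale by (rule vector_space_nw_scale)
  have lookup_W: "Poly_Mapping.lookup (W n) m = (if n = m then 1 else 0)" for n m
    by (simp add: W_def lookup_single when_def)
  show inj: "inj W"
    by (rule injI) (metis lookup_W zero_neq_one)
  show "independent (range W)"
    unfolding independent_explicit_module
  proof (intro allI impI)
    fix t u v
    assume t: "finite t" "t \<subseteq> range W" and 0: "(\<Sum>v\<in>t. nw_scale (u v) v) = 0" and v: "v \<in> t"
    obtain n where n: "v = W n" using t v by blast
    have "0 = Poly_Mapping.lookup (\<Sum>v\<in>t. nw_scale (u v) v) n" by (simp add: 0)
    also have "\<dots> = (\<Sum>w\<in>t. if w = v then u w else 0)"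
      unfolding lookup_sum
      by (rule sum.cong) (use t inj in \<open>auto simp: lookup_W n inj_eq\<close>)
    also have "\<dots> = u v" using t v by simp
    finally show "u v = 0" by simp
  qed
  have "x \<in> span (range W)" for x
    by (subst nw_sum_W) (intro span_sum span_scale span_base rangeI)
  then show "span (range W) = UNIV" by auto
qed

definition D1 :: "nw \<Rightarrow> nw" where
  "D1 = nw_extend (\<lambda>n. nw_scale (of_int n) (W n))"

(* For gamma = 3 k the index shift gamma / 3 is the integer k. *)
definition D2 :: "complex \<Rightarrow> int \<Rightarrow> nw \<Rightarrow> nw" where
  "D2 \<gamma> k = nw_extend (\<lambda>n. nw_scale (of_int n + \<gamma> / 3) (W (n - k)))"

definition F :: "complex \<Rightarrow> int \<Rightarrow> nw \<Rightarrow> nw" where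
  "F \<gamma> j = nw_extend (\<lambda>n. nw_scale (of_int n + \<gamma> / 3) (W (n + j)))"

definition F' :: "complex \<Rightarrow> int \<Rightarrow> nw \<Rightarrow> nw" where
  "F' \<gamma> j = nw_extend (\<lambda>n. nw_scale (of_int n + of_int j + 2 * \<gamma> / 3) (W (n + j)))"

definition end_span :: "(nw \<Rightarrow> nw) set \<Rightarrow> (nw \<Rightarrow> nw) set" where
  "end_span S = module.span (fun_scale nw_scale) S"

definition QDer_star :: "complex \<Rightarrow> (nw \<Rightarrow> nw) set" where
  "QDer_star \<gamma> = end_span {F \<gamma> j | j :: int. (of_int j :: complex) \<notin> {0, - \<gamma> / 3}}"

end

theory Submission
  imports Defs
begin

text \<open>
  Decompose a quasi-derivation \<open>f\<close> with related mapping \<open>f'\<close> by degree: let \<open>a j n\<close> and \<open>b j n\<close>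
  be the coefficients of \<open>W (n + j)\<close> in \<open>f (W n)\<close> and \<open>f' (W n)\<close>. The defining equation on
  \<open>(W n, W m)\<close> and on \<open>(W m, W n)\<close> gives two linear equations for each \<open>j\<close>. For \<open>j = 0\<close> they say
  \<open>a 0 n + a 0 m = b 0 (n + m)\<close> for \<open>n \<noteq> m\<close>, so \<open>a 0\<close> is affine; for \<open>j \<noteq> 0\<close> eliminating \<open>b j\<close>
  leaves \<open>a j n * (m + \<gamma>/3) = a j m * (n + \<gamma>/3)\<close>, so \<open>a j n\<close> is a multiple of \<open>n + \<gamma>/3\<close>. Hence \<open>f\<close>
  is a combination of \<open>id\<close>, \<open>D1\<close> and finitely many \<open>F \<gamma> j\<close>, and comparing coefficients
  once more singles out the derivations and the \<open>1/2\<close>-derivations.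
\<close>

subsection \<open>Linear maps and coefficients\<close>

interpretation nw: vector_space nw_scale
  by (rule vector_space_nw_scale)

interpretation nw_end: vector_space "fun_scale nw_scale"
  by (rule vector_space_fun_scale[OF vector_space_nw_scale])

lemma lookup_W: "Poly_Mapping.lookup (W n) m = (if n = m then 1 else 0)"
  by (simp add: W_def lookup_single when_def)

lemma lookup_fun_scale [simp]:
  "Poly_Mapping.lookup (fun_scale nw_scale c f x) i = c * Poly_Mapping.lookup (f x) i"
  by (simp add: fun_scale_def)

text \<open>Multiplication by a basis vector, on either side, is such a weighted shift, so one
  formula yields both product rules below. If \<open>i - m\<close> lies outside the support of
  \<open>x\<close>, both sides are 0.\<close>

lemma lookup_shift:
  "Poly_Mapping.lookup (nw_extend (\<lambda>n. nw_scale (h n) (W (n + m))) x) i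
     = h (i - m) * Poly_Mapping.lookup x (i - m)"
proof -
  have "Poly_Mapping.lookup (nw_extend (\<lambda>n. nw_scale (h n) (W (n + m))) x) i
      = (\<Sum>n\<in>Poly_Mapping.keys x. if n = i - m then h n * Poly_Mapping.lookup x n else 0)"
    unfolding nw_extend_def lookup_sum by (rule sum.cong) (auto simp: lookup_W)
  also have "\<dots> = h (i - m) * Poly_Mapping.lookup x (i - m)"
    by (simp add: in_keys_iff)
  finally show ?thesis .
qed

lemma lookup_nw_mult_W_right:
  "Poly_Mapping.lookup (nw_mult \<gamma> x (W m)) i
     = (\<gamma> + of_int m + 2 * of_int (i - m)) * Poly_Mapping.lookup x (i - m)"
  by (simp only: nw_mult_def nw_extend_W lookup_shift)

lemma lookup_nw_mult_W_left:
  "Poly_Mapping.lookup (nw_mult \<gamma> (W n) y) i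
     = (\<gamma> + of_int (i - n) + 2 * of_int n) * Poly_Mapping.lookup y (i - n)"
  by (simp only: nw_mult_def nw_extend_W add.commute[of n] lookup_shift)

lemma nw_linear_eqI:
  assumes "Vector_Spaces.linear nw_scale nw_scale f" "Vector_Spaces.linear nw_scale nw_scale g"
    and "\<And>n. f (W n) = g (W n)"
  shows "f = g"
proof
  fix x
  interpret vector_space_pair nw_scale nw_scale ..
  show "f x = g x"
    by (rule linear_eq_on_span[OF assms(1,2), of "range W"]) (use assms(3) basis_W(3) in auto)
qed

lemma nw_linear_coeff_eqI:
  assumes "Vector_Spaces.linear nw_scale nw_scale f" "Vector_Spaces.linear nw_scale nw_scale g"
    and "\<And>n j. Poly_Mapping.lookup (f (W n)) (n + j) = Poly_Mapping.lookup (g (W n)) (n + j)"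
  shows "f = g"
proof (rule nw_linear_eqI[OF assms(1,2)], rule poly_mapping_eqI)
  fix n i
  show "Poly_Mapping.lookup (f (W n)) i = Poly_Mapping.lookup (g (W n)) i"
    using assms(3)[of n "i - n"] by simp
qed

lemma nw_mult_linear:
  "nw_mult \<gamma> (x + y) z = nw_mult \<gamma> x z + nw_mult \<gamma> y z"
  "nw_mult \<gamma> x (y + z) = nw_mult \<gamma> x y + nw_mult \<gamma> x z"
  "nw_mult \<gamma> (nw_scale c x) y = nw_scale c (nw_mult \<gamma> x y)"
  "nw_mult \<gamma> x (nw_scale c y) = nw_scale c (nw_mult \<gamma> x y)"
  using linear_nw_mult_left[of \<gamma>] linear_nw_mult_right[of \<gamma>] unfolding nw_linear_iff by auto

lemma nw_mult_0: "nw_mult \<gamma> 0 x = 0" "nw_mult \<gamma> x 0 = 0"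
  using nw_mult_linear(3)[of \<gamma> 0 0 x] nw_mult_linear(4)[of \<gamma> x 0 0] by simp_all

lemma nw_linear_0: "Vector_Spaces.linear nw_scale nw_scale 0"
  by (simp add: nw_linear_iff)

lemma nw_linear_id: "Vector_Spaces.linear nw_scale nw_scale id"
  by (simp add: nw_linear_iff)

lemma nw_linear_add:
  "Vector_Spaces.linear nw_scale nw_scale f \<Longrightarrow> Vector_Spaces.linear nw_scale nw_scale g \<Longrightarrow>
    Vector_Spaces.linear nw_scale nw_scale (f + g)"
  by (simp add: nw_linear_iff nw.scale_right_distrib algebra_simps)

lemma nw_linear_scale:
  "Vector_Spaces.linear nw_scale nw_scale f \<Longrightarrow>
    Vector_Spaces.linear nw_scale nw_scale (fun_scale nw_scale c f)"
  by (simp add: nw_linear_iff fun_scale_def nw.scale_right_distrib mult.commute)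

lemma subspace_linear: "nw_end.subspace {f. Vector_Spaces.linear nw_scale nw_scale f}"
  by (rule nw_end.subspaceI) (use nw_linear_0 nw_linear_add nw_linear_scale in blast)+

lemma nw_linear_D1: "Vector_Spaces.linear nw_scale nw_scale D1"
  unfolding D1_def by (rule linear_nw_extend)

lemma nw_linear_F: "Vector_Spaces.linear nw_scale nw_scale (F \<gamma> j)"
  unfolding F_def by (rule linear_nw_extend)

lemma nw_linear_F': "Vector_Spaces.linear nw_scale nw_scale (F' \<gamma> j)"
  unfolding F'_def by (rule linear_nw_extend)

lemma D1_W: "D1 (W n) = nw_scale (of_int n) (W n)"
  by (simp add: D1_def)

lemma F_W: "F \<gamma> j (W n) = nw_scale (of_int n + \<gamma> / 3) (W (n + j))"
  by (simp add: F_def)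

lemma F'_W: "F' \<gamma> j (W n) = nw_scale (of_int n + of_int j + 2 * \<gamma> / 3) (W (n + j))"
  by (simp add: F'_def)

subsection \<open>Quasi-derivations\<close>

text \<open>Both sides of the identity are bilinear, so basis pairs suffice. The extension runs one
  argument at a time: first \<open>x\<close> against \<open>W m\<close>, then \<open>y\<close>
  against arbitrary \<open>x\<close>.\<close>

lemma is_quasi_derivation_WI:
  assumes f: "Vector_Spaces.linear nw_scale nw_scale f"
    and f': "Vector_Spaces.linear nw_scale nw_scale f'"
    and W: "\<And>n m. nw_mult \<gamma> (f (W n)) (W m) + nw_mult \<gamma> (W n) (f (W m)) = f' (nw_mult \<gamma> (W n) (W m))"
  shows "is_quasi_derivation nw_scale (nw_mult \<gamma>) f f'"
proof -
  have 1: "(\<lambda>x. nw_mult \<gamma> (f x) (W m) + nw_mult \<gamma> x (f (W m))) = (\<lambda>x. f' (nw_mult \<gamma> x (W m)))" for m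
    by (rule nw_linear_eqI)
      (use f f' W in \<open>simp_all add: nw_linear_iff nw_mult_linear nw.scale_right_distrib algebra_simps\<close>)
  have 2: "(\<lambda>y. nw_mult \<gamma> (f x) y + nw_mult \<gamma> x (f y)) = (\<lambda>y. f' (nw_mult \<gamma> x y))" for x
    by (rule nw_linear_eqI)
      (use f f' fun_cong[OF 1] in
        \<open>simp_all add: nw_linear_iff nw_mult_linear nw.scale_right_distrib algebra_simps\<close>)
  show ?thesis
    unfolding is_quasi_derivation_def using f f' fun_cong[OF 2] by blast
qed

text \<open>Put s = \<gamma> + m + 2 n, the structure constant of \<open>(W n, W m)\<close>. The
  terms free of \<open>j\<close> add up to s (n + m + 2 \<gamma>/3), those with \<open>j\<close> to
  j (2 n + m + \<gamma>) = j s. The weight n + \<gamma>/3 is what makes s a common factor.\<close>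

lemma is_quasi_derivation_F: "is_quasi_derivation nw_scale (nw_mult \<gamma>) (F \<gamma> j) (F' \<gamma> j)"
proof (rule is_quasi_derivation_WI[OF nw_linear_F nw_linear_F'])
  fix n m
  have F'_scale: "F' \<gamma> j (nw_scale c x) = nw_scale c (F' \<gamma> j x)" for c x
    using nw_linear_F' nw_linear_iff by blast
  have "n + j + m = n + m + j" by simp
  then have 1: "nw_mult \<gamma> (F \<gamma> j (W n)) (W m)
      = nw_scale ((of_int n + \<gamma> / 3) * (\<gamma> + of_int m + 2 * of_int (n + j))) (W (n + m + j))"
    by (simp only: F_W nw_mult_linear nw_mult_W nw.scale_scale)
  have "n + (m + j) = n + m + j" by simp
  then have 2: "nw_mult \<gamma> (W n) (F \<gamma> j (W m))
      = nw_scale ((of_int m + \<gamma> / 3) * (\<gamma> + of_int (m + j) + 2 * of_int n)) (W (n + m + j))"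
    by (simp only: F_W nw_mult_linear nw_mult_W nw.scale_scale)
  \<comment> \<open>Removes the fractions, so that the scalar identity becomes polynomial.\<close>
  define g where "g = \<gamma> / 3"
  have \<gamma>: "\<gamma> = 3 * g" by (simp add: g_def)
  have 3: "(of_int n + \<gamma> / 3) * (\<gamma> + of_int m + 2 * of_int (n + j))
      + (of_int m + \<gamma> / 3) * (\<gamma> + of_int (m + j) + 2 * of_int n)
      = (\<gamma> + of_int m + 2 * of_int n) * (of_int (n + m) + of_int j + 2 * \<gamma> / 3)"
    unfolding \<gamma> by (simp add: algebra_simps)
  show "nw_mult \<gamma> (F \<gamma> j (W n)) (W m) + nw_mult \<gamma> (W n) (F \<gamma> j (W m)) =
      F' \<gamma> j (nw_mult \<gamma> (W n) (W m))"
    by (simp only: 1 2 3 F'_W F'_scale nw_mult_W nw.scale_scale nw.scale_left_distrib[symmetric])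
qed

lemma is_quasi_derivation_D1: "is_quasi_derivation nw_scale (nw_mult \<gamma>) D1 D1"
proof (rule is_quasi_derivation_WI[OF nw_linear_D1 nw_linear_D1])
  fix n m
  have D1_scale: "D1 (nw_scale c x) = nw_scale c (D1 x)" for c x
    using nw_linear_D1 nw_linear_iff by blast
  have scalars: "of_int n * (\<gamma> + of_int m + 2 * of_int n) + of_int m * (\<gamma> + of_int m + 2 * of_int n)
      = (\<gamma> + of_int m + 2 * of_int n) * of_int (n + m)"
    by (simp add: algebra_simps)
  show "nw_mult \<gamma> (D1 (W n)) (W m) + nw_mult \<gamma> (W n) (D1 (W m)) = D1 (nw_mult \<gamma> (W n) (W m))"
    by (simp only: D1_W D1_scale nw_mult_linear nw_mult_W nw.scale_scale
        nw.scale_left_distrib[symmetric] scalars)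
qed

section \<open>Delta-derivations as quasi-derivations, and subspace properties\<close>

text \<open>Dividing by \<delta> turns the condition into one with a related mapping:
  \<open>f\<close> itself for derivations, twice \<open>f\<close> for 1/2-derivations. One analysis
  of coefficients thus serves all three spaces.\<close>

lemma delta_derivations_iff:
  assumes "\<delta> \<noteq> 0"
  shows "f \<in> delta_derivations nw_scale (nw_mult \<gamma>) \<delta> \<longleftrightarrow>
    is_quasi_derivation nw_scale (nw_mult \<gamma>) f (fun_scale nw_scale (1 / \<delta>) f)"
proof -
  have "f (nw_mult \<gamma> x y) = nw_scale \<delta> z \<longleftrightarrow> z = nw_scale (1 / \<delta>) (f (nw_mult \<gamma> x y))" for x y z
    using assms by auto
  then show ?thesis
    unfolding delta_derivations_def is_quasi_derivation_def
    using nw_linear_scale by (auto simp: fun_scale_def)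
qed

lemma derivations_iff:
  "f \<in> derivations nw_scale (nw_mult \<gamma>) \<longleftrightarrow> is_quasi_derivation nw_scale (nw_mult \<gamma>) f f"
  by (simp add: derivations_def delta_derivations_iff fun_scale_def)

lemma subspace_delta_derivations:
  "nw_end.subspace (delta_derivations nw_scale (nw_mult \<gamma>) \<delta>)"
proof (rule nw_end.subspaceI)
  show "0 \<in> delta_derivations nw_scale (nw_mult \<gamma>) \<delta>"
    by (simp add: delta_derivations_def nw_linear_0 nw_mult_0)
next
  fix f g
  assume "f \<in> delta_derivations nw_scale (nw_mult \<gamma>) \<delta>"
    "g \<in> delta_derivations nw_scale (nw_mult \<gamma>) \<delta>"
  then show "f + g \<in> delta_derivations nw_scale (nw_mult \<gamma>) \<delta>"
    by (auto simp: delta_derivations_def nw_linear_add nw_mult_linear nw.scale_right_distrib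
        algebra_simps)
next
  fix c f
  assume "f \<in> delta_derivations nw_scale (nw_mult \<gamma>) \<delta>"
  then show "fun_scale nw_scale c f \<in> delta_derivations nw_scale (nw_mult \<gamma>) \<delta>"
    by (auto simp: delta_derivations_def nw_linear_scale)
      (auto simp: fun_scale_def nw_mult_linear nw.scale_right_distrib mult.commute)
qed

lemma subspace_derivations: "nw_end.subspace (derivations nw_scale (nw_mult \<gamma>))"
  unfolding derivations_def by (rule subspace_delta_derivations)

lemma subspace_quasi_derivations: "nw_end.subspace (quasi_derivations nw_scale (nw_mult \<gamma>))"
proof (rule nw_end.subspaceI)
  have "is_quasi_derivation nw_scale (nw_mult \<gamma>) 0 0"
    by (simp add: is_quasi_derivation_def nw_linear_0 nw_mult_0)
  then show "0 \<in> quasi_derivations nw_scale (nw_mult \<gamma>)"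
    unfolding quasi_derivations_def by blast
next
  fix f g
  assume "f \<in> quasi_derivations nw_scale (nw_mult \<gamma>)" "g \<in> quasi_derivations nw_scale (nw_mult \<gamma>)"
  then obtain f' g' where f': "is_quasi_derivation nw_scale (nw_mult \<gamma>) f f'"
    and g': "is_quasi_derivation nw_scale (nw_mult \<gamma>) g g'"
    unfolding quasi_derivations_def by blast
  have "nw_mult \<gamma> ((f + g) x) y + nw_mult \<gamma> x ((f + g) y) = (f' + g') (nw_mult \<gamma> x y)" for x y
  proof -
    have "nw_mult \<gamma> ((f + g) x) y + nw_mult \<gamma> x ((f + g) y)
        = (nw_mult \<gamma> (f x) y + nw_mult \<gamma> x (f y)) + (nw_mult \<gamma> (g x) y + nw_mult \<gamma> x (g y))"
      by (simp add: nw_mult_linear algebra_simps)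
    then show ?thesis
      using f' g' by (simp add: is_quasi_derivation_def)
  qed
  then have "is_quasi_derivation nw_scale (nw_mult \<gamma>) (f + g) (f' + g')"
    using f' g' nw_linear_add unfolding is_quasi_derivation_def by blast
  then show "f + g \<in> quasi_derivations nw_scale (nw_mult \<gamma>)"
    unfolding quasi_derivations_def by blast
next
  fix c f
  assume "f \<in> quasi_derivations nw_scale (nw_mult \<gamma>)"
  then obtain f' where f': "is_quasi_derivation nw_scale (nw_mult \<gamma>) f f'"
    unfolding quasi_derivations_def by blast
  then have "is_quasi_derivation nw_scale (nw_mult \<gamma>) (fun_scale nw_scale c f) (fun_scale nw_scale c f')"
    unfolding is_quasi_derivation_def
    by (auto simp: nw_linear_scale)
      (auto simp: fun_scale_def nw_mult_linear nw.scale_right_distrib[symmetric])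
  then show "fun_scale nw_scale c f \<in> quasi_derivations nw_scale (nw_mult \<gamma>)"
    unfolding quasi_derivations_def by blast
qed

lemma delta_derivation_imp_quasi_derivation:
  "\<delta> \<noteq> 0 \<Longrightarrow> f \<in> delta_derivations nw_scale (nw_mult \<gamma>) \<delta> \<Longrightarrow>
    f \<in> quasi_derivations nw_scale (nw_mult \<gamma>)"
  unfolding delta_derivations_iff quasi_derivations_def by blast

lemma D1_derivation: "D1 \<in> derivations nw_scale (nw_mult \<gamma>)"
  by (simp add: derivations_iff is_quasi_derivation_D1)

text \<open>At this \<open>j\<close> the weight n + j + 2 \<gamma>/3 of \<open>F'\<close> equals the
  weight n + \<gamma>/3 of \<open>F\<close>, so \<open>F\<close> is its own related mapping.\<close>

lemma F_derivation:
  assumes "of_int j = - \<gamma> / 3"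
  shows "F \<gamma> j \<in> derivations nw_scale (nw_mult \<gamma>)"
proof -
  have "F' \<gamma> j = F \<gamma> j"
    unfolding F_def F'_def using assms by (simp add: field_simps)
  then show ?thesis
    using is_quasi_derivation_F[of \<gamma> j] by (simp add: derivations_iff)
qed

lemma id_half_derivation: "id \<in> delta_derivations nw_scale (nw_mult \<gamma>) (1 / 2)"
proof -
  have "nw_scale (1 / 2) (z + z) = z" for z
    unfolding nw.scale_right_distrib nw.scale_left_distrib[symmetric] by simp
  then show ?thesis
    by (simp only: delta_derivations_def nw_linear_id id_apply mem_Collect_eq simp_thms)
qed

subsection \<open>Coefficients of quasi-derivations\<close>

text \<open>This is the coefficient of \<open>W (n + m + j)\<close> in the defining equation on
  \<open>(W n, W m)\<close>. Only the degree \<open>j\<close> parts of \<open>f\<close> and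
  \<open>f'\<close> enter, so the degrees decouple.\<close>

lemma quasi_derivation_coeff:
  fixes n m j :: int
  assumes "is_quasi_derivation nw_scale (nw_mult \<gamma>) f f'"
  shows "Poly_Mapping.lookup (f (W n)) (n + j) * (\<gamma> + of_int m + 2 * of_int n + 2 * of_int j)
      + Poly_Mapping.lookup (f (W m)) (m + j) * (\<gamma> + of_int m + 2 * of_int n + of_int j)
      = (\<gamma> + of_int m + 2 * of_int n) * Poly_Mapping.lookup (f' (W (n + m))) (n + m + j)"
proof -
  have "f' (nw_scale c x) = nw_scale c (f' x)" for c x
    using assms nw_linear_iff unfolding is_quasi_derivation_def by blast
  then have "nw_mult \<gamma> (f (W n)) (W m) + nw_mult \<gamma> (W n) (f (W m))
      = nw_scale (\<gamma> + of_int m + 2 * of_int n) (f' (W (n + m)))"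
    using assms unfolding is_quasi_derivation_def by (simp add: nw_mult_W)
  from arg_cong[OF this, of "\<lambda>x. Poly_Mapping.lookup x (n + m + j)"] show ?thesis
    by (simp add: lookup_add lookup_nw_mult_W_left lookup_nw_mult_W_right algebra_simps)
qed

text \<open>Comparing the pairs \<open>(n + 1, 0)\<close> and \<open>(n, 1)\<close> shows that
  consecutive differences are constant. The diagonal is excluded because in the application the
  relation carries a factor \<open>n - m\<close>.\<close>

lemma affine_if_sums_agree:
  fixes a b :: "int \<Rightarrow> complex"
  assumes "\<And>n m. n \<noteq> m \<Longrightarrow> a n + a m = b (n + m)"
  shows "a n = a 0 + (a 1 - a 0) * of_int n"
proof -
  have sums: "a n + a m = a k + a l" if "n \<noteq> m" "k \<noteq> l" "n + m = k + l" for n m k l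
    using assms[of n m] assms[of k l] that by simp
  \<comment> \<open>Subtracting the relations for sums 2 and 3 cancels \<open>a 3\<close> and
    \<open>a 2\<close>; all four pairs are off the diagonal.\<close>
  have m1: "a (- 1) = 2 * a 0 - a 1"
    using sums[of 3 "- 1" 2 0, simplified] sums[of 3 0 2 1, simplified] by algebra
  \<comment> \<open>For \<open>n = 1\<close> and \<open>n = - 1\<close> one of the two compared
    pairs is diagonal; there the value at \<open>- 1\<close> helps out.\<close>
  have up: "a (n + 1) = a n + (a 1 - a 0)" for n
  proof (cases "n = 1 \<or> n = - 1")
    case True
    have "a 2 = a 1 + (a 1 - a 0)"
      using m1 sums[of 2 "- 1" 1 0, simplified] by algebra
    moreover have "a 0 = a (- 1) + (a 1 - a 0)"
      using m1 by algebra
    ultimately show ?thesis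
      using True by auto
  next
    case False
    then show ?thesis
      using sums[of "n + 1" 0 n 1] by (simp add: algebra_simps)
  qed
  show ?thesis
  proof (induction n rule: int_induct[of _ 0])
    case (step1 i)
    then show ?case using up[of i] unfolding of_int_add of_int_1 by algebra
  next
    case (step2 i)
    then show ?case using up[of "i - 1", simplified] unfolding of_int_diff of_int_1 by algebra
  qed simp
qed

text \<open>The parameters are the coordinates of \<open>f\<close> with respect to
  \<open>id\<close>, \<open>D1\<close> and the \<open>F \<gamma> j\<close>. Since
  \<open>F \<gamma> 0\<close> is itself a combination of \<open>id\<close> and \<open>D1\<close>,
  the condition \<open>C 0 = 0\<close> keeps the coordinates unambiguous.\<close>

definition coeff_form ::
    "complex \<Rightarrow> (nw \<Rightarrow> nw) \<Rightarrow> complex \<Rightarrow> complex \<Rightarrow> (int \<Rightarrow> complex) \<Rightarrow> bool" where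
  "coeff_form \<gamma> f c0 c1 C \<longleftrightarrow> C 0 = 0 \<and>
     (\<forall>j n. Poly_Mapping.lookup (f (W n)) (n + j)
        = (if j = 0 then c0 + c1 * of_int n else 0) + C j * (of_int n + \<gamma> / 3))"

lemma coeff_formD:
  assumes "coeff_form \<gamma> f c0 c1 C"
  shows "C 0 = 0"
    and "Poly_Mapping.lookup (f (W n)) (n + j)
      = (if j = 0 then c0 + c1 * of_int n else 0) + C j * (of_int n + \<gamma> / 3)"
  using assms unfolding coeff_form_def by auto

lemma int_shift_nonzero:
  fixes z :: "'a::ring_1"
  obtains m :: int where "of_int m + z \<noteq> 0"
proof (cases "z = 0")
  case True
  with that[of 1] show ?thesis by simp
qed (use that[of 0] in simp)

lemma quasi_derivation_coeff_form:
  assumes q: "is_quasi_derivation nw_scale (nw_mult \<gamma>) f f'"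
  obtains c0 c1 C where "coeff_form \<gamma> f c0 c1 C"
proof -
  define a where "a j n = Poly_Mapping.lookup (f (W n)) (n + j)" for j n
  define b where "b j n = Poly_Mapping.lookup (f' (W n)) (n + j)" for j n
  have eq: "a j n * (\<gamma> + of_int m + 2 * of_int n + 2 * of_int j)
      + a j m * (\<gamma> + of_int m + 2 * of_int n + of_int j)
      = (\<gamma> + of_int m + 2 * of_int n) * b j (n + m)" for j n m
    using quasi_derivation_coeff[OF q, of n j m] unfolding a_def b_def .
  \<comment> \<open>Difference of the equations for \<open>(n, m)\<close> and \<open>(m, n)\<close>;
    \<open>b j (n + m)\<close> is common to both.\<close>
  have eq1: "a j n * (of_int n - of_int m + of_int j) + a j m * (of_int n - of_int m - of_int j)
      = (of_int n - of_int m) * b j (n + m)" for j n m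
    using eq[of j n m] eq[of j m n] by (simp add: add.commute[of m n]) algebra
  \<comment> \<open>Sum of the same two equations.\<close>
  have eq2: "(2 * \<gamma> + 3 * of_int n + 3 * of_int m + 3 * of_int j) * (a j n + a j m)
      = (2 * \<gamma> + 3 * of_int n + 3 * of_int m) * b j (n + m)" for j n m
    using eq[of j n m] eq[of j m n] by (simp add: add.commute[of m n]) algebra
  have zero: "a 0 n = a 0 0 + (a 0 1 - a 0 0) * of_int n" for n
  proof (rule affine_if_sums_agree)
    fix n m :: int
    assume "n \<noteq> m"
    moreover have "(of_int n - of_int m) * (a 0 n + a 0 m) = (of_int n - of_int m) * b 0 (n + m)"
      using eq1[of 0 n m] by (simp add: algebra_simps)
    ultimately show "a 0 n + a 0 m = b 0 (n + m)" by simp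
  qed
  have nonzero: "a j n * (of_int m + \<gamma> / 3) = a j m * (of_int n + \<gamma> / 3)" if "j \<noteq> 0" for j n m
  proof -
    \<comment> \<open>Multiplying \<open>eq2\<close> by n - m and \<open>eq1\<close> by 2 \<gamma> +
      3 n + 3 m makes the right sides equal; what remains has the factor \<open>j\<close>.\<close>
    have "of_int j * (a j n * (6 * of_int m + 2 * \<gamma>))
        = (of_int j :: complex) * (a j m * (6 * of_int n + 2 * \<gamma>))"
      using eq1[of j n m] eq2[of n m j] eq2[of j n m] by algebra
    with that have "a j n * (6 * of_int m + 2 * \<gamma>) = a j m * (6 * of_int n + 2 * \<gamma>)"
      by (simp only: mult_cancel_left of_int_eq_0_iff) simp
    moreover have "x * (of_int i + \<gamma> / 3) = x * (6 * of_int i + 2 * \<gamma>) / 6" for x and i :: int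
      by (simp add: field_simps)
    ultimately show ?thesis by (simp only:)
  qed
  obtain m0 :: int where m0: "of_int m0 + \<gamma> / 3 \<noteq> 0"
    by (rule int_shift_nonzero)
  \<comment> \<open>By \<open>nonzero\<close> the quotient is the same for every admissible
    \<open>m0\<close>.\<close>
  define C where "C j = (if j = 0 then 0 else a j m0 / (of_int m0 + \<gamma> / 3))" for j
  have "Poly_Mapping.lookup (f (W n)) (n + j)
      = (if j = 0 then a 0 0 + (a 0 1 - a 0 0) * of_int n else 0) + C j * (of_int n + \<gamma> / 3)" for j n
  proof (cases "j = 0")
    case True
    then show ?thesis using zero[of n] by (simp add: C_def a_def)
  next
    case False
    then show ?thesis
      using nonzero[of j n m0] m0 by (simp add: C_def a_def[symmetric] eq_divide_eq)
  qed
  then have "coeff_form \<gamma> f (a 0 0) (a 0 1 - a 0 0) C"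
    unfolding coeff_form_def by (simp add: C_def)
  then show thesis by (rule that)
qed

text \<open>The set of nonzero \<open>C j\<close> is finite because \<open>f (W n)\<close> has finite support for a single
  \<open>n \<noteq> -\<gamma>/3\<close>.\<close>

lemma linear_from_coeff_form:
  assumes f: "Vector_Spaces.linear nw_scale nw_scale f"
    and form: "coeff_form \<gamma> f c0 c1 C"
  shows "finite {j. C j \<noteq> 0}"
    and "f = fun_scale nw_scale c0 id + fun_scale nw_scale c1 D1
      + (\<Sum>j | C j \<noteq> 0. fun_scale nw_scale (C j) (F \<gamma> j))"
proof -
  note C0 = coeff_formD(1)[OF form] and coeff = coeff_formD(2)[OF form]
  obtain n :: int where n: "of_int n + \<gamma> / 3 \<noteq> 0"
    by (rule int_shift_nonzero)
  have "{j. C j \<noteq> 0} \<subseteq> (\<lambda>i. i - n) ` Poly_Mapping.keys (f (W n))"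
  proof
    fix j assume "j \<in> {j. C j \<noteq> 0}"
    then have "Poly_Mapping.lookup (f (W n)) (n + j) \<noteq> 0"
      using coeff[of n j] n C0 by (cases "j = 0") auto
    then show "j \<in> (\<lambda>i. i - n) ` Poly_Mapping.keys (f (W n))"
      by (intro image_eqI[of _ _ "n + j"]) (auto simp: in_keys_iff)
  qed
  then show fin: "finite {j. C j \<noteq> 0}"
    by (rule finite_subset) simp
  have sum_apply: "(\<Sum>j\<in>J. fun_scale nw_scale (C j) (F \<gamma> j)) x
      = (\<Sum>j\<in>J. fun_scale nw_scale (C j) (F \<gamma> j) x)" for J :: "int set" and x
    by (induction J rule: infinite_finite_induct) auto
  have lin_sum: "Vector_Spaces.linear nw_scale nw_scale (\<Sum>j\<in>J. fun_scale nw_scale (C j) (F \<gamma> j))"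
    for J :: "int set"
    by (intro nw_end.subspace_sum[OF subspace_linear, unfolded mem_Collect_eq]
        nw_linear_scale nw_linear_F)
  show "f = fun_scale nw_scale c0 id + fun_scale nw_scale c1 D1
      + (\<Sum>j | C j \<noteq> 0. fun_scale nw_scale (C j) (F \<gamma> j))"
  proof (rule nw_linear_coeff_eqI[OF f])
    fix n j
    \<comment> \<open>\<open>F \<gamma> i\<close> sends \<open>W n\<close> into degree
      \<open>n + i\<close>, so only \<open>i = j\<close> contributes; if \<open>C j = 0\<close>,
      both values are 0.\<close>
    have "Poly_Mapping.lookup ((\<Sum>j | C j \<noteq> 0. fun_scale nw_scale (C j) (F \<gamma> j)) (W n)) (n + j)
        = (\<Sum>i | C i \<noteq> 0. if i = j then C i * (of_int n + \<gamma> / 3) else 0)"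
      unfolding sum_apply lookup_sum by (rule sum.cong) (auto simp: F_W lookup_W)
    also have "\<dots> = C j * (of_int n + \<gamma> / 3)"
      using fin by simp
    finally show "Poly_Mapping.lookup (f (W n)) (n + j)
        = Poly_Mapping.lookup ((fun_scale nw_scale c0 id + fun_scale nw_scale c1 D1
            + (\<Sum>j | C j \<noteq> 0. fun_scale nw_scale (C j) (F \<gamma> j))) (W n)) (n + j)"
      using coeff[of n j] by (auto simp: lookup_add D1_W lookup_W)
  qed (intro nw_linear_add nw_linear_scale nw_linear_id nw_linear_D1 lin_sum)
qed

section \<open>Derivations and 1/2-derivations\<close>

lemma derivation_coeff_form:
  assumes "f \<in> derivations nw_scale (nw_mult \<gamma>)"
  obtains c1 C where "coeff_form \<gamma> f 0 c1 C" "\<forall>j. C j \<noteq> 0 \<longrightarrow> of_int j = - \<gamma> / 3"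
proof -
  have q: "is_quasi_derivation nw_scale (nw_mult \<gamma>) f f"
    using assms by (simp add: derivations_iff)
  obtain c0 c1 C where form: "coeff_form \<gamma> f c0 c1 C"
    by (rule quasi_derivation_coeff_form[OF q])
  note C0 = coeff_formD(1)[OF form] and coeff = coeff_formD(2)[OF form]
  \<comment> \<open>On \<open>(W 0, W m)\<close> the equation with \<open>f' = f\<close> reduces to
    c0 (\<gamma> + m) = 0 in degree 0 and to C j (\<gamma> + m) (j + \<gamma>/3) = 0 in degree
    \<open>j \<noteq> 0\<close>, so \<gamma> + m must be cancelled.\<close>
  obtain m :: int where "of_int m + \<gamma> \<noteq> 0"
    by (rule int_shift_nonzero)
  then have m: "\<gamma> + of_int m \<noteq> 0"
    by (simp add: add.commute)
  note eq = quasi_derivation_coeff[OF q, of 0 _ m, unfolded coeff]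
  have "c0 * (\<gamma> + of_int m) = 0"
    using eq[of 0] by (simp add: C0 algebra_simps)
  with m have c0: "c0 = 0" by simp
  have "of_int j = - \<gamma> / 3" if "C j \<noteq> 0" for j
  proof -
    from that C0 have j: "j \<noteq> 0" by auto
    define g where "g = \<gamma> / 3"
    have \<gamma>: "\<gamma> = 3 * g" by (simp add: g_def)
    have "C j * ((\<gamma> + of_int m) * (of_int j + \<gamma> / 3)) = 0"
      using eq[of j] unfolding \<gamma> if_not_P[OF j] by (simp del: mult_eq_0_iff) algebra
    with that m show ?thesis by (simp add: eq_neg_iff_add_eq_0)
  qed
  with form c0 show thesis
    by (intro that) auto
qed

lemma half_derivation_scalar:
  assumes "f \<in> delta_derivations nw_scale (nw_mult \<gamma>) (1 / 2)"
  obtains c where "f = fun_scale nw_scale c id"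
proof -
  have q: "is_quasi_derivation nw_scale (nw_mult \<gamma>) f (fun_scale nw_scale 2 f)"
    using assms by (simp add: delta_derivations_iff)
  obtain c0 c1 C where form: "coeff_form \<gamma> f c0 c1 C"
    by (rule quasi_derivation_coeff_form[OF q])
  note C0 = coeff_formD(1)[OF form] and coeff = coeff_formD(2)[OF form]
  note eq = quasi_derivation_coeff[OF q, unfolded lookup_fun_scale coeff]
  \<comment> \<open>Degree 0 on \<open>(W 0, W m)\<close> with related mapping twice
    \<open>f\<close> gives c1 m (\<gamma> + m) = 0. At most one of \<gamma> + 1 and \<gamma> + 2
    vanishes, so 1 or 2 serves.\<close>
  obtain m :: int where m: "m \<noteq> 0" "\<gamma> + of_int m \<noteq> 0"
  proof (cases "\<gamma> + 1 = 0")
    case True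
    then have "\<gamma> + of_int 2 \<noteq> 0" by (simp add: add_eq_0_iff2)
    with that[of 2] show ?thesis by simp
  qed (use that[of 1] in simp)
  have "c1 * (of_int m * (\<gamma> + of_int m)) = 0"
    using eq[of 0 0 m] by (simp add: C0 algebra_simps)
  with m have c1: "c1 = 0" by simp
  have C: "C j = 0" for j
  proof (rule ccontr)
    assume nz: "C j \<noteq> 0"
    with C0 have j: "j \<noteq> 0" by auto
    \<comment> \<open>On \<open>(W n, W (m - 2 n))\<close> the factor \<open>\<gamma> + m\<close> does not depend on \<open>n\<close>, so \<open>n\<close> can be chosen
      to make the degree \<open>m - n\<close> differ from \<open>j\<close>.\<close>
    define n where "n = m - j - 1"
    define g where "g = \<gamma> / 3"
    have \<gamma>: "\<gamma> = 3 * g" by (simp add: g_def)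
    have "C j * ((\<gamma> + of_int m) * (of_int j - of_int (m - n))) = 0"
      using eq[of j n "m - 2 * n"] unfolding \<gamma> if_not_P[OF j] by (simp del: mult_eq_0_iff) algebra
    moreover have "j - (m - n) = - 1" by (simp add: n_def)
    then have "(of_int j - of_int (m - n) :: complex) = - 1"
      by (metis of_int_diff of_int_1 of_int_minus)
    ultimately show False using nz m by simp
  qed
  have "Vector_Spaces.linear nw_scale nw_scale f"
    using q by (simp add: is_quasi_derivation_def)
  from linear_from_coeff_form(2)[OF this form] have "f = fun_scale nw_scale c0 id"
    by (simp add: C c1)
  then show thesis by (rule that)
qed

lemma half_derivations_eq: "delta_derivations nw_scale (nw_mult \<gamma>) (1 / 2) = end_span {id}"
proof
  show "delta_derivations nw_scale (nw_mult \<gamma>) (1 / 2) \<subseteq> end_span {id}"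
  proof
    fix f assume "f \<in> delta_derivations nw_scale (nw_mult \<gamma>) (1 / 2)"
    then obtain c where "f = fun_scale nw_scale c id"
      by (rule half_derivation_scalar)
    then show "f \<in> end_span {id}"
      unfolding end_span_def by (simp add: nw_end.span_scale nw_end.span_base)
  qed
  show "end_span {id} \<subseteq> delta_derivations nw_scale (nw_mult \<gamma>) (1 / 2)"
    unfolding end_span_def
    by (rule nw_end.span_minimal) (simp_all add: id_half_derivation subspace_delta_derivations)
qed

text \<open>The set of admissible \<open>j\<close> is empty or a singleton according to whether
  \<gamma> is three times an integer, so both cases of the theorem are covered at once.\<close>

lemma derivations_eq:
  "derivations nw_scale (nw_mult \<gamma>) = end_span (insert D1 {F \<gamma> j | j :: int. of_int j = - \<gamma> / 3})"
    (is "_ = end_span ?S")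
proof
  show "derivations nw_scale (nw_mult \<gamma>) \<subseteq> end_span ?S"
  proof
    fix f assume f: "f \<in> derivations nw_scale (nw_mult \<gamma>)"
    then have lin: "Vector_Spaces.linear nw_scale nw_scale f"
      by (simp add: derivations_iff is_quasi_derivation_def)
    obtain c1 C where form: "coeff_form \<gamma> f 0 c1 C"
      and C: "\<forall>j. C j \<noteq> 0 \<longrightarrow> of_int j = - \<gamma> / 3"
      by (rule derivation_coeff_form[OF f])
    have "f = fun_scale nw_scale c1 D1 + (\<Sum>j | C j \<noteq> 0. fun_scale nw_scale (C j) (F \<gamma> j))"
      using linear_from_coeff_form(2)[OF lin form] by simp
    also have "\<dots> \<in> end_span ?S"
      unfolding end_span_def
      by (intro nw_end.span_add nw_end.span_sum nw_end.span_scale nw_end.span_base)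
        (use C in auto)
    finally show "f \<in> end_span ?S" .
  qed
  show "end_span ?S \<subseteq> derivations nw_scale (nw_mult \<gamma>)"
    unfolding end_span_def
    by (rule nw_end.span_minimal)
      (auto intro: D1_derivation F_derivation simp: subspace_derivations)
qed

section \<open>The direct sum\<close>

text \<open>The generators shift only by the other degrees, and vanishing of a coefficient passes to
  the span. This separates \<open>QDer_star\<close> from \<open>id\<close> and from the
  derivations.\<close>

lemma QDer_star_coeff:
  assumes "f \<in> QDer_star \<gamma>" "(of_int j :: complex) \<in> {0, - \<gamma> / 3}"
  shows "Poly_Mapping.lookup (f (W n)) (n + j) = 0"
proof -
  have "QDer_star \<gamma> \<subseteq> {f. Poly_Mapping.lookup (f (W n)) (n + j) = 0}"
    unfolding QDer_star_def end_span_def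
    by (rule nw_end.span_minimal)
      (use assms(2) in \<open>auto intro!: nw_end.subspaceI simp: F_W lookup_W lookup_add\<close>)
  with assms(1) show ?thesis by auto
qed

lemma QDer_star_subset: "QDer_star \<gamma> \<subseteq> quasi_derivations nw_scale (nw_mult \<gamma>)"
  unfolding QDer_star_def end_span_def
  by (rule nw_end.span_minimal[OF _ subspace_quasi_derivations])
    (use is_quasi_derivation_F in \<open>auto simp: quasi_derivations_def\<close>)

text \<open>The \<open>id\<close> term is the 1/2-derivation; \<open>D1\<close> and the possible
  \<open>F \<gamma> j\<close> with j = -\<gamma>/3 form the derivation; the remaining
  \<open>F \<gamma> j\<close> go to \<open>QDer_star\<close>, where \<open>C 0 = 0\<close> rules out
  the index 0.\<close>

lemma quasi_derivation_decompose:
  assumes "f \<in> quasi_derivations nw_scale (nw_mult \<gamma>)"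
  obtains a b c where "f = a + b + c" "a \<in> derivations nw_scale (nw_mult \<gamma>)"
    "b \<in> delta_derivations nw_scale (nw_mult \<gamma>) (1 / 2)" "c \<in> QDer_star \<gamma>"
proof -
  obtain f' where q: "is_quasi_derivation nw_scale (nw_mult \<gamma>) f f'"
    using assms by (auto simp: quasi_derivations_def)
  obtain c0 c1 C where form: "coeff_form \<gamma> f c0 c1 C"
    by (rule quasi_derivation_coeff_form[OF q])
  note C0 = coeff_formD(1)[OF form]
  have lin: "Vector_Spaces.linear nw_scale nw_scale f"
    using q by (simp add: is_quasi_derivation_def)
  define J where "J = {j. C j \<noteq> 0}"
  define K where "K = {j. of_int j = - \<gamma> / 3}"
  define S where "S I = (\<Sum>j\<in>I. fun_scale nw_scale (C j) (F \<gamma> j))" for I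
  have fin: "finite J"
    unfolding J_def by (rule linear_from_coeff_form(1)[OF lin form])
  have "f = fun_scale nw_scale c0 id + fun_scale nw_scale c1 D1 + S J"
    unfolding J_def S_def by (rule linear_from_coeff_form(2)[OF lin form])
  also have "S J = S (J \<inter> K) + S (J - K)"
    unfolding S_def by (rule sum.Int_Diff[OF fin])
  finally have "f = (fun_scale nw_scale c1 D1 + S (J \<inter> K)) + fun_scale nw_scale c0 id + S (J - K)"
    by (simp only: add_ac)
  moreover have "fun_scale nw_scale c1 D1 + S (J \<inter> K) \<in> derivations nw_scale (nw_mult \<gamma>)"
    unfolding S_def
    by (intro nw_end.subspace_add nw_end.subspace_sum nw_end.subspace_scale
        subspace_derivations D1_derivation F_derivation) (auto simp: K_def)
  moreover have "fun_scale nw_scale c0 id \<in> delta_derivations nw_scale (nw_mult \<gamma>) (1 / 2)"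
    by (intro nw_end.subspace_scale subspace_delta_derivations id_half_derivation)
  moreover have "S (J - K) \<in> QDer_star \<gamma>"
    unfolding S_def QDer_star_def end_span_def
    by (intro nw_end.span_sum nw_end.span_scale nw_end.span_base)
      (use C0 in \<open>auto simp: J_def K_def\<close>)
  ultimately show thesis by (rule that)
qed

lemma decomposition_independent:
  assumes a: "a \<in> derivations nw_scale (nw_mult \<gamma>)"
    and b: "b \<in> delta_derivations nw_scale (nw_mult \<gamma>) (1 / 2)"
    and c: "c \<in> QDer_star \<gamma>" and sum: "a + b + c = 0"
  shows "a = 0 \<and> b = 0 \<and> c = 0"
proof -
  obtain c1 C where form: "coeff_form \<gamma> a 0 c1 C"
    and C: "\<forall>j. C j \<noteq> 0 \<longrightarrow> of_int j = - \<gamma> / 3"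
    by (rule derivation_coeff_form[OF a])
  obtain c0 where b0: "b = fun_scale nw_scale c0 id"
    by (rule half_derivation_scalar[OF b])
  have "Poly_Mapping.lookup ((a + b + c) (W n)) (n + j) = 0" for n j
    by (simp add: sum)
  then have total: "Poly_Mapping.lookup (a (W n)) (n + j) + c0 * (if j = 0 then 1 else 0)
      + Poly_Mapping.lookup (c (W n)) (n + j) = 0" for n j
    by (simp add: lookup_add b0 lookup_W)
  \<comment> \<open>Degree 0, where \<open>c\<close> has no coefficient; \<open>n = 0\<close> and
    \<open>n = 1\<close> then kill both constants.\<close>
  have "c1 * of_int n + c0 = 0" for n :: int
    using total[of n 0] QDer_star_coeff[OF c, of 0 n] coeff_formD(1)[OF form] coeff_formD(2)[OF form, of n 0] by simp
  from this[of 0] this[of 1] have c01: "c0 = 0" "c1 = 0" by simp_all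
  \<comment> \<open>In degree -\<gamma>/3 this is \<open>QDer_star_coeff\<close>; in any other
    degree \<open>a\<close> and \<open>b\<close> have nothing left to cancel against
    \<open>c\<close>.\<close>
  have "Poly_Mapping.lookup (c (W n)) (n + j) = 0" for n j
  proof (cases "(of_int j :: complex) = - \<gamma> / 3")
    case True
    then show ?thesis using QDer_star_coeff[OF c, of j n] by simp
  next
    case False
    then have "C j = 0" using C by auto
    then show ?thesis using total[of n j] coeff_formD(2)[OF form, of n j] c01
      by (simp split: if_splits)
  qed
  moreover have "Vector_Spaces.linear nw_scale nw_scale c"
    using QDer_star_subset c by (auto simp: quasi_derivations_def is_quasi_derivation_def)
  ultimately have "c = 0"
    by (intro nw_linear_coeff_eqI nw_linear_0) simp_all
  moreover have "b = 0"
    by (simp add: b0 c01)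
  ultimately show ?thesis using sum by simp
qed

theorem proposition13:
  fixes \<gamma> :: complex
  shows
    "((\<nexists>k::int. \<gamma> = 3 * of_int k) \<longrightarrow>
        derivations nw_scale (nw_mult \<gamma>) = end_span {D1}) \<and>
     (\<forall>k::int. \<gamma> = 3 * of_int k \<longrightarrow>
        derivations nw_scale (nw_mult \<gamma>) = end_span {D1, D2 \<gamma> k}) \<and>
     delta_derivations nw_scale (nw_mult \<gamma>) (1 / 2) = end_span {id} \<and>
     (\<forall>j::int. (of_int j :: complex) \<notin> {0, - \<gamma> / 3} \<longrightarrow>
        is_quasi_derivation nw_scale (nw_mult \<gamma>) (F \<gamma> j) (F' \<gamma> j)) \<and>
     is_direct_sum3 (fun_scale nw_scale)
       (quasi_derivations nw_scale (nw_mult \<gamma>))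
       (derivations nw_scale (nw_mult \<gamma>))
       (delta_derivations nw_scale (nw_mult \<gamma>) (1 / 2))
       (QDer_star \<gamma>)"
proof (intro conjI impI allI)
  assume "\<nexists>k::int. \<gamma> = 3 * of_int k"
  \<comment> \<open>Otherwise \<gamma> = 3 (-j), so \<open>- j\<close> would be the excluded
    integer.\<close>
  then have "of_int j \<noteq> - \<gamma> / 3" for j :: int
    by (auto simp: field_simps dest: spec[of _ "- j"])
  then show "derivations nw_scale (nw_mult \<gamma>) = end_span {D1}"
    by (simp add: derivations_eq)
next
  fix k :: int
  assume k: "\<gamma> = 3 * of_int k"
  have "of_int j = - \<gamma> / 3 \<longleftrightarrow> j = - k" for j :: int
    unfolding k by simp (metis of_int_eq_iff of_int_minus)
  moreover have "F \<gamma> (- k) = D2 \<gamma> k"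
    by (simp add: F_def D2_def)
  ultimately show "derivations nw_scale (nw_mult \<gamma>) = end_span {D1, D2 \<gamma> k}"
    by (simp add: derivations_eq)
next
  show "delta_derivations nw_scale (nw_mult \<gamma>) (1 / 2) = end_span {id}"
    by (rule half_derivations_eq)
next
  fix j :: int
  show "is_quasi_derivation nw_scale (nw_mult \<gamma>) (F \<gamma> j) (F' \<gamma> j)"
    by (rule is_quasi_derivation_F)
next
  have star: "nw_end.subspace (QDer_star \<gamma>)"
    by (simp add: QDer_star_def end_span_def)
  have sum: "quasi_derivations nw_scale (nw_mult \<gamma>) = {a + b + c | a b c.
      a \<in> derivations nw_scale (nw_mult \<gamma>) \<and>
      b \<in> delta_derivations nw_scale (nw_mult \<gamma>) (1 / 2) \<and> c \<in> QDer_star \<gamma>}" (is "?Q = ?R")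
  proof
    show "?Q \<subseteq> ?R"
    proof
      fix f assume "f \<in> ?Q"
      then show "f \<in> ?R"
        by (rule quasi_derivation_decompose) blast
    qed
    show "?R \<subseteq> ?Q"
    proof
      fix f assume "f \<in> ?R"
      then obtain a b c where f: "f = a + b + c" and abc: "a \<in> derivations nw_scale (nw_mult \<gamma>)"
        "b \<in> delta_derivations nw_scale (nw_mult \<gamma>) (1 / 2)" "c \<in> QDer_star \<gamma>"
        by blast
      have "a \<in> ?Q"
        using delta_derivation_imp_quasi_derivation[of 1] abc(1) by (simp add: derivations_def)
      moreover have "b \<in> ?Q"
        using delta_derivation_imp_quasi_derivation[of "1 / 2"] abc(2) by simp
      moreover have "c \<in> ?Q"
        using QDer_star_subset abc(3) by blast
      ultimately show "f \<in> ?Q"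
        unfolding f by (intro nw_end.subspace_add subspace_quasi_derivations)
    qed
  qed
  have indep: "\<forall>a\<in>derivations nw_scale (nw_mult \<gamma>).
      \<forall>b\<in>delta_derivations nw_scale (nw_mult \<gamma>) (1 / 2). \<forall>c\<in>QDer_star \<gamma>.
        a + b + c = 0 \<longrightarrow> a = 0 \<and> b = 0 \<and> c = 0"
    by (intro ballI impI decomposition_independent)
  show "is_direct_sum3 (fun_scale nw_scale)
       (quasi_derivations nw_scale (nw_mult \<gamma>))
       (derivations nw_scale (nw_mult \<gamma>))
       (delta_derivations nw_scale (nw_mult \<gamma>) (1 / 2))
       (QDer_star \<gamma>)"
    unfolding is_direct_sum3_def
    by (intro conjI subspace_derivations subspace_delta_derivations star sum indep)
qed

end
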